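(* Let $P$ and $Q$ be Laurent polynomials in the variables $x_1,\ldots,x_r$ with integer coefficients, and let $p^a$ be a prime power ($p$ prime, $a\geq 1$). Then the sequence $\left(\mathrm{ct}(P^nQ)\bmod p^a\right)_{n\in\mathbb{N}}$ is linearly recurrent if and only if $p\nmid \mathrm{ct}(P^n)$ for all $n\in\mathbb{N}$; moreover there is a bound $B_{P,p}\in\mathbb{N}$, depending only on $p$ and $\deg(P)$ (for the fixed number of variables $r$), such that this condition can be checked on the finitely many $n<B_{P,p}$ (i.e. if $p\mid\mathrm{ct}(P^n)$ for some $n$, then $p\mid \mathrm{ct}(P^{n_0})$ for some $n_0<B_{P,p}$). When the sequence is not linearly recurrent, the value $0$ has frequency $1$ in it. In particular, this classification is independent of $Q$ and of the exponent $a$.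
   Context: $\mathbb{N}=\{0,1,2,\ldots\}$. For a Laurent polynomial $Q$, $\mathrm{ct}(Q)$ denotes its constant term. $\deg Q$ denotes the largest absolute value of any exponent of any single variable appearing in $Q$ (e.g. $\deg(5x^{-3}y^{-2}+2xy^{-1})=3$). A sequence $(s_n)$ is uniformly recurrent if for every finite word $w=s_is_{i+1}\cdots s_{i+\ell-1}$ occurring in it there is a constant $C_w$ such that every occurrence of $w$ is followed by another occurrence of $w$ starting at distance at most $C_w$; it is linearly recurrent if moreover $C_w$ can be chosen bounded by a constant multiple of the length of $w$ (uniformly over all $w$). The frequency of a value $c$ in $(s_n)$ is the asymptotic density of $\{n\in\mathbb{N}: s_n=c\}$.
   Formalization: The equivalence and the independence of Q and a are stated only for sequences that are not identically 0, since for P=Q=x the sequence is constantly 0, hence linearly recurrent, although p divides ct(P); the "if" direction, the bound and the frequency claim are unconditional. *)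

theory Defs
  imports
    Complex_Main
    "HOL-Library.Poly_Mapping"
    "HOL-Analysis.Finite_Cartesian_Product"
    "HOL-Computational_Algebra.Primes"
begin

text \<open>
  Integer Laurent polynomials in the variables indexed by a finite type \<open>'r\<close>: finitely supported
  maps from exponent vectors in \<open>int ^ 'r\<close> to coefficients. Multiplication is the convolution
  product of \<^theory>\<open>HOL-Library.Poly_Mapping\<close>.
\<close>

type_synonym 'r laurent = "(int ^ 'r) \<Rightarrow>\<^sub>0 int"

definition ct :: "'r::finite laurent \<Rightarrow> int" where
  "ct Q = Poly_Mapping.lookup Q 0"

text \<open>The element 0 is inserted only to fix the degree of the zero polynomial as 0.\<close>

definition laurent_deg :: "'r::finite laurent \<Rightarrow> nat" where
  "laurent_deg Q = Max (insert 0 {nat \<bar>e $ i\<bar> | e i. e \<in> Poly_Mapping.keys Q})"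

definition ct_seq :: "'r::finite laurent \<Rightarrow> 'r laurent \<Rightarrow> nat \<Rightarrow> nat \<Rightarrow> int" where
  "ct_seq P Q m n = ct (P ^ n * Q) mod int m"

definition occurs_at :: "(nat \<Rightarrow> 'a) \<Rightarrow> 'a list \<Rightarrow> nat \<Rightarrow> bool" where
  "occurs_at s w i \<longleftrightarrow> map s [i..<i + length w] = w"

text \<open>
  The empty word is excluded: it recurs at distance 1, which is not bounded by any multiple of
  its length.
\<close>

definition factors :: "(nat \<Rightarrow> 'a) \<Rightarrow> 'a list set" where
  "factors s = {w. w \<noteq> [] \<and> (\<exists>i. occurs_at s w i)}"

definition recurs_within :: "(nat \<Rightarrow> 'a) \<Rightarrow> 'a list \<Rightarrow> nat \<Rightarrow> bool" where
  "recurs_within s w C \<longleftrightarrow>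
     (\<forall>i. occurs_at s w i \<longrightarrow> (\<exists>j. i < j \<and> j \<le> i + C \<and> occurs_at s w j))"

definition uniformly_recurrent :: "(nat \<Rightarrow> 'a) \<Rightarrow> bool" where
  "uniformly_recurrent s \<longleftrightarrow> (\<forall>w\<in>factors s. \<exists>C. recurs_within s w C)"

definition linearly_recurrent :: "(nat \<Rightarrow> 'a) \<Rightarrow> bool" where
  "linearly_recurrent s \<longleftrightarrow> uniformly_recurrent s \<and>
     (\<exists>K. \<forall>w\<in>factors s. \<exists>C \<le> K * length w. recurs_within s w C)"

definition has_frequency :: "(nat \<Rightarrow> 'a) \<Rightarrow> 'a \<Rightarrow> real \<Rightarrow> bool" where
  "has_frequency s c d \<longleftrightarrow>
     (\<lambda>N. real (card {n. n < N \<and> s n = c}) / real N) \<longlonglongrightarrow> d"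

end

theory Submission
  imports Defs "HOL-Number_Theory.Residues"
begin

text \<open>
  Put \<open>R = P^(p^(a-1))\<close>. The Frobenius congruence \<open>R(x)^(p^k) \<equiv> R(x^(p^k))\<close> modulo \<open>p^a\<close> gives
  \<open>ct (R^(u p^k) B) \<equiv> ct (R^u \<Lambda> B)\<close>, where the Cartier operator \<open>\<Lambda>\<close> keeps the monomials whose
  exponents are divisible by \<open>p^k\<close> and divides these exponents by \<open>p^k\<close>. When the exponents of \<open>B\<close>
  are smaller than \<open>p^k\<close>, this is \<open>ct (R^u) ct B\<close>, so \<open>c n = ct (R^n)\<close> is multiplicative on
  concatenations of base-\<open>p\<close> expansions that are separated by enough zeros.

  If \<open>p\<close> never divides \<open>ct (P^n)\<close>, then the values of \<open>c\<close> form a finite subset of the unit group closed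
  under multiplication, hence a group, and every long enough block contains some \<open>u\<close> with \<open>c u = 1\<close>.
  Prepending such a \<open>u\<close> to the digits of \<open>m\<close> preserves the central coefficients of
  \<open>R^m\<close>, which determine the block of length \<open>p^(a-1+j)\<close> number \<open>m\<close> of the sequence for every \<open>j\<close>.
  If \<open>p\<close> divides \<open>ct (P^n0)\<close>, then each occurrence in \<open>n\<close> of the digits of \<open>n0\<close>, padded with zeros,
  contributes a factor \<open>p\<close> to \<open>ct (P^n Q)\<close>, and almost all \<open>n\<close> have at least \<open>a\<close> such occurrences.
  The bound exists because only finitely many Laurent polynomials modulo \<open>p\<close> have a given degree.
\<close>

subsection \<open>Laurent polynomials modulo prime powers\<close>

lemma of_nat_prime_dvd_power_add:
  fixes A B :: "'a::comm_ring_1"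
  assumes "prime p"
  shows "of_nat p dvd (A + B) ^ p - (A ^ p + B ^ p)"
proof -
  let ?t = "\<lambda>k. of_nat (p choose k) * A ^ k * B ^ (p - k)"
  have "p > 0" using assms by (rule prime_gt_0_nat)
  then have "{..p} = insert 0 (insert p {0<..<p})" by auto
  then have "(A + B) ^ p - (A ^ p + B ^ p) = (\<Sum>k\<in>{0<..<p}. ?t k)"
    using \<open>p > 0\<close> by (simp add: binomial_ring algebra_simps)
  also have "of_nat p dvd \<dots>"
  proof (rule dvd_sum)
    fix k assume "k \<in> {0<..<p}"
    then have "p dvd p choose k"
      using assms by (intro dvd_choose_prime) auto
    then show "of_nat p dvd ?t k"
      by (metis dvd_def dvd_mult2 of_nat_mult)
  qed
  finally show ?thesis .
qed

text \<open>The cofactor of \<open>A - B\<close> in \<open>A ^ p - B ^ p\<close> is congruent to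
  \<open>p * B ^ (p - 1)\<close> modulo \<open>p\<close>, which supplies the additional factor
  \<open>p\<close>.\<close>

lemma of_nat_prime_power_dvd_power_diff:
  fixes A B :: "'a::comm_ring_1"
  assumes "of_nat (p ^ Suc k) dvd A - B"
  shows "of_nat (p ^ Suc (Suc k)) dvd A ^ p - B ^ p"
proof -
  have AB: "of_nat p dvd A - B"
    using assms by (metis dvd_mult_left of_nat_mult power_Suc)
  have "of_nat p dvd (\<Sum>i<p. B ^ (p - Suc i) * A ^ i)"
  proof -
    have "of_nat p dvd (\<Sum>i<p. B ^ (p - Suc i) * (A ^ i - B ^ i))"
    proof (intro dvd_sum dvd_mult)
      fix i show "of_nat p dvd A ^ i - B ^ i"
        using AB by (metis dvd_mult2 power_diff_sumr2)
    qed
    moreover have "(\<Sum>i<p. B ^ (p - Suc i) * B ^ i) = of_nat p * B ^ (p - 1)"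
      by (simp flip: power_add)
    ultimately show ?thesis
      by (simp add: right_diff_distrib sum_subtractf dvd_diff_left_iff)
  qed
  with assms have "of_nat (p ^ Suc k) * of_nat p dvd (A - B) * (\<Sum>i<p. B ^ (p - Suc i) * A ^ i)"
    by (rule mult_dvd_mono)
  then show ?thesis
    by (simp add: power_diff_sumr2 mult.commute mult.left_commute)
qed

definition pcong :: "nat \<Rightarrow> 'a::comm_ring_1 \<Rightarrow> 'a \<Rightarrow> bool" where
  "pcong m A B \<longleftrightarrow> of_nat m dvd A - B"

lemma pcong_refl [simp]: "pcong m A A"
  by (simp add: pcong_def)

lemma pcong_trans [trans]: "pcong m A B \<Longrightarrow> pcong m B C \<Longrightarrow> pcong m A C"
  unfolding pcong_def using dvd_add by fastforce

lemma pcong_mult: "pcong m A B \<Longrightarrow> pcong m C D \<Longrightarrow> pcong m (A * C) (B * D)"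
proof -
  assume "pcong m A B" "pcong m C D"
  then have "of_nat m dvd (A - B) * C + B * (C - D)"
    unfolding pcong_def by (intro dvd_add dvd_mult dvd_mult2)
  then show ?thesis by (simp add: pcong_def algebra_simps)
qed

lemma pcong_power: "pcong m A B \<Longrightarrow> pcong m (A ^ n) (B ^ n)"
  by (induction n) (auto intro: pcong_mult)

text \<open>\<open>frag_of e\<close> is the monomial with exponent vector \<open>e\<close>;
  \<open>frag_induction\<close> reduces identities compatible with subtraction to monomials.\<close>

lemma frag_of_mult: "frag_of e * frag_of f = frag_of (e + f)"
  by (simp add: mult_single)

lemma frag_of_power: "frag_of e ^ n = frag_of (of_nat n *s (e :: int ^ 'r::finite))"
  by (induction n) (auto simp: frag_of_mult vector_sadd_rdistrib add.commute)

lemma lookup_frag_of_mult: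
  "Poly_Mapping.lookup (frag_of e * A) x = Poly_Mapping.lookup A (x - (e :: 'a::ab_group_add))"
proof (induction A rule: frag_induction[OF subset_UNIV])
  case (2 f)
  have "x = e + f \<longleftrightarrow> x - e = f" by (auto simp: algebra_simps)
  then show ?case by (simp only: frag_of_mult) (auto simp: lookup_single when_def)
qed (auto simp: right_diff_distrib lookup_minus)

lemma ct_diff: "ct (A - B) = ct A - ct B"
  by (simp add: ct_def lookup_minus)

lemma ct_one [simp]: "ct 1 = 1"
  by (simp add: ct_def)

lemma frag_cmul_eq: "frag_cmul c A = of_int c * (A :: 'a::monoid_add \<Rightarrow>\<^sub>0 int)"
proof -
  have "frag_cmul c A = Poly_Mapping.map ((*) c) A"
    by (rule poly_mapping_eqI) (simp add: Poly_Mapping.map.rep_eq when_def)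
  also have "\<dots> = of_int c * A"
    using single_of_int[of c, where ?'b = int and ?'a = 'a] by (simp add: mult_map_scale_conv_mult)
  finally show ?thesis .
qed

lemma of_int_dvd_iff_lookup:
  "of_int c dvd (A :: 'a::comm_monoid_add \<Rightarrow>\<^sub>0 int) \<longleftrightarrow> (\<forall>e. c dvd Poly_Mapping.lookup A e)"
proof
  assume "of_int c dvd A"
  then obtain C where "A = frag_cmul c C" by (auto simp: frag_cmul_eq elim: dvdE)
  then show "\<forall>e. c dvd Poly_Mapping.lookup A e" by simp
next
  assume *: "\<forall>e. c dvd Poly_Mapping.lookup A e"
  have "A = frag_cmul c (Poly_Mapping.map (\<lambda>x. x div c) A)"
    by (rule poly_mapping_eqI) (use * in \<open>auto simp: Poly_Mapping.map.rep_eq when_def\<close>)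
  then show "of_int c dvd A" by (metis dvd_triv_left frag_cmul_eq)
qed

lemma pcong_iff_lookup:
  "pcong m A B \<longleftrightarrow> (\<forall>e. [Poly_Mapping.lookup A e = Poly_Mapping.lookup B e] (mod int m))"
  for A B :: "'a::comm_monoid_add \<Rightarrow>\<^sub>0 int"
  using of_int_dvd_iff_lookup[of "int m" "A - B"]
  by (simp add: pcong_def lookup_minus cong_iff_dvd_diff)

lemma pcong_ct: "pcong m A B \<Longrightarrow> [ct A = ct B] (mod int m)"
  by (simp add: pcong_iff_lookup ct_def)

text \<open>Degrees are tracked as bounds \<open>keys A \<subseteq> box D\<close>, which pass easily
  to products and powers.\<close>

definition box :: "nat \<Rightarrow> (int ^ 'r::finite) set" where
  "box D = {e. \<forall>i. \<bar>e $ i\<bar> \<le> int D}"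

lemma finite_box: "finite (box D :: (int ^ 'r::finite) set)"
proof (rule finite_subset)
  show "box D \<subseteq> vec_lambda ` (UNIV \<rightarrow>\<^sub>E {- int D..int D} :: ('r \<Rightarrow> int) set)"
  proof
    fix e :: "int ^ 'r" assume "e \<in> box D"
    then have "vec_nth e \<in> UNIV \<rightarrow>\<^sub>E {- int D..int D}"
      by (auto simp: box_def abs_le_iff minus_le_iff)
    then show "e \<in> vec_lambda ` (UNIV \<rightarrow>\<^sub>E {- int D..int D})"
      by (metis image_eqI vec_nth_inverse)
  qed
qed (auto intro!: finite_imageI finite_PiE)

lemma uminus_in_box: "e \<in> box D \<Longrightarrow> - e \<in> box D"
  by (simp add: box_def)

lemma box_mono: "D \<le> E \<Longrightarrow> box D \<subseteq> box E"
  unfolding box_def by (blast intro: order_trans of_nat_mono)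

lemma keys_mult_box:
  assumes "Poly_Mapping.keys A \<subseteq> box D" "Poly_Mapping.keys B \<subseteq> box E"
  shows "Poly_Mapping.keys (A * B :: 'r::finite laurent) \<subseteq> box (D + E)"
proof
  fix x assume "x \<in> Poly_Mapping.keys (A * B)"
  then obtain e f where "x = e + f" "e \<in> box D" "f \<in> box E"
    using keys_mult[of A B] assms by blast
  then show "x \<in> box (D + E)"
    by (auto simp: box_def intro: order_trans[OF abs_triangle_ineq] add_mono)
qed

lemma keys_power_box:
  assumes "Poly_Mapping.keys A \<subseteq> box D"
  shows "Poly_Mapping.keys (A ^ n :: 'r::finite laurent) \<subseteq> box (n * D)"
proof (induction n)
  case (Suc n)
  then show ?case using keys_mult_box[OF assms Suc] by simp
qed (simp add: box_def)

lemma keys_box_laurent_deg: "Poly_Mapping.keys P \<subseteq> box (laurent_deg P)"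
proof
  fix e assume e: "e \<in> Poly_Mapping.keys P"
  let ?S = "{nat \<bar>e $ i\<bar> | e i. e \<in> Poly_Mapping.keys P}"
  have "?S = (\<Union>e\<in>Poly_Mapping.keys P. range (\<lambda>i. nat \<bar>e $ i\<bar>))" by auto
  then have fin: "finite ?S" by simp
  have "nat \<bar>e $ i\<bar> \<le> laurent_deg P" for i
    unfolding laurent_deg_def using fin e by (intro Max_ge) auto
  then show "e \<in> box (laurent_deg P)" by (simp add: box_def nat_le_iff)
qed

text \<open>A monomial with exponent \<open>e\<close> moves the coefficient at \<open>- e\<close> to
  the constant term, and \<open>box D\<close> is symmetric.\<close>

lemma ct_mult_cong:
  assumes "Poly_Mapping.keys C \<subseteq> box D"
    and "\<And>e. e \<in> box D \<Longrightarrow> [Poly_Mapping.lookup A e = Poly_Mapping.lookup B e] (mod m)"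
  shows "[ct (A * C) = ct (B * C)] (mod m)"
  using assms(1)
proof (induction C rule: frag_induction)
  case (one e)
  then show ?case
    using assms(2)[OF uminus_in_box]
    by (metis ct_def diff_0 lookup_frag_of_mult mult.commute)
qed (auto simp: right_diff_distrib ct_diff intro: cong_diff)

section \<open>Substitution of \<open>q\<close>-th powers for the variables, and the Frobenius
  congruence\<close>

definition subst_pow :: "nat \<Rightarrow> 'r::finite laurent \<Rightarrow> 'r laurent" where
  "subst_pow q = frag_extend (\<lambda>e. frag_of (int q *s e))"

lemma subst_pow_0 [simp]: "subst_pow q 0 = 0"
  by (simp add: subst_pow_def)

lemma subst_pow_frag_of: "subst_pow q (frag_of e) = frag_of (int q *s e)"
  by (simp add: subst_pow_def)

lemma subst_pow_diff: "subst_pow q (A - B) = subst_pow q A - subst_pow q B"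
  by (simp add: subst_pow_def frag_extend_diff)

lemma subst_pow_mult: "subst_pow q (A * B) = subst_pow q A * subst_pow q B"
proof (induction A rule: frag_induction[OF subset_UNIV])
  case (2 e)
  show ?case
  proof (induction B rule: frag_induction[OF subset_UNIV])
    case (2 f)
    show ?case by (simp only: frag_of_mult subst_pow_frag_of vector_add_ldistrib)
  qed (auto simp: subst_pow_diff right_diff_distrib )
qed (auto simp: subst_pow_diff left_diff_distrib)

lemma subst_pow_power: "subst_pow q (A ^ n) = subst_pow q A ^ n"
proof (induction n)
  case 0
  show ?case using subst_pow_frag_of[of q 0] by simp
qed (simp add: subst_pow_mult)

lemma subst_pow_comp: "subst_pow q (subst_pow q' A) = subst_pow (q * q') A"
  by (induction A rule: frag_induction[OF subset_UNIV])
    (auto simp: subst_pow_diff subst_pow_frag_of vector_smult_assoc)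

lemma subst_pow_pcong:
  assumes "pcong m A B"
  shows "pcong m (subst_pow q A) (subst_pow q B)"
proof -
  obtain C where "A - B = frag_cmul (int m) C"
    using assms by (auto simp: pcong_def frag_cmul_eq elim: dvdE)
  then have "subst_pow q A - subst_pow q B = frag_cmul (int m) (subst_pow q C)"
    by (metis frag_extend_cmul subst_pow_def subst_pow_diff)
  then show ?thesis by (simp add: pcong_def frag_cmul_eq)
qed

lemma frobenius:
  assumes "prime p"
  shows "pcong p (A ^ p) (subst_pow p A)"
proof (induction A rule: frag_induction[OF subset_UNIV])
  case 1
  then show ?case using prime_gt_0_nat[OF assms] by (simp add: zero_power)
next
  case (2 e)
  then show ?case by (simp only: frag_of_power subst_pow_frag_of) simp
next
  case (3 A B)
  \<comment> \<open>The induction passes to differences, so the power is expanded for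
    \<open>A = (A - B) + B\<close>.\<close>
  from dvd_diff[OF dvd_diff[OF 3[unfolded pcong_def]]
      of_nat_prime_dvd_power_add[OF assms, of "A - B" B]]
  show ?case by (simp add: pcong_def subst_pow_diff algebra_simps)
qed

text \<open>In the first induction each further \<open>p\<close>-th power gains one factor
  \<open>p\<close> in the modulus, which is why \<open>R\<close> has the exponent
  \<open>p ^ (a - 1)\<close>; the second iterates the substitution.\<close>

lemma frobenius_prime_power:
  fixes P :: "'r::finite laurent"
  assumes "prime p" "a \<ge> 1"
  defines "R \<equiv> P ^ p ^ (a - 1)"
  shows "pcong (p ^ a) (R ^ p ^ k) (subst_pow (p ^ k) R)"
proof -
  have "pcong (p ^ Suc b) (P ^ p ^ Suc b) (subst_pow p (P ^ p ^ b))" for b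
  proof (induction b)
    case 0
    then show ?case using frobenius[OF assms(1)] by simp
  next
    case (Suc b)
    then show ?case
      using of_nat_prime_power_dvd_power_diff[of p b "P ^ p ^ Suc b" "subst_pow p (P ^ p ^ b)"]
      by (simp add: pcong_def flip: power_mult subst_pow_power) (simp add: mult.commute)
  qed
  from this[of "a - 1"] have 1: "pcong (p ^ a) (R ^ p) (subst_pow p R)"
    using assms(2) by (simp add: R_def mult.commute flip: power_mult power_Suc)
  show ?thesis
  proof (induction k)
    case 0
    have "subst_pow 1 R = R"
      by (induction R rule: frag_induction[OF subset_UNIV])
        (auto simp: subst_pow_diff  subst_pow_frag_of)
    then show ?case by simp
  next
    case (Suc k)
    have "pcong (p ^ a) ((R ^ p ^ k) ^ p) (subst_pow (p ^ k) (R ^ p))"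
      using pcong_power[OF Suc] by (simp add: subst_pow_power)
    also have "pcong (p ^ a) (subst_pow (p ^ k) (R ^ p)) (subst_pow (p ^ k) (subst_pow p R))"
      by (rule subst_pow_pcong[OF 1])
    finally show ?case by (simp add: subst_pow_comp mult.commute flip: power_mult)
  qed
qed

section \<open>The Cartier operator\<close>

definition cartier :: "nat \<Rightarrow> 'r::finite laurent \<Rightarrow> 'r laurent" where
  "cartier q = Poly_Mapping.map_key (\<lambda>e. int q *s e)"

lemma lookup_cartier:
  assumes "q > 0"
  shows "Poly_Mapping.lookup (cartier q A) e = Poly_Mapping.lookup A (int q *s e)"
proof -
  have "inj (\<lambda>e :: int ^ 'a. int q *s e)"
    using assms by (intro injI) (simp add: vec_eq_iff)
  then show ?thesis by (simp add: cartier_def Poly_Mapping.map_key.rep_eq)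
qed

lemma ct_cartier: "q > 0 \<Longrightarrow> ct (cartier q A) = ct A"
  by (simp add: ct_def lookup_cartier)

text \<open>The projection formula: if \<open>A\<close> is the monomial with exponent
  \<open>e\<close>, the coefficient at \<open>f\<close> is on both sides that of \<open>B\<close> at
  \<open>q * (f - e)\<close>.\<close>

lemma cartier_subst_pow_mult:
  assumes "q > 0"
  shows "cartier q (subst_pow q A * B) = A * cartier q B"
proof (induction A rule: frag_induction[OF subset_UNIV])
  case 1
  then show ?case
    by (intro poly_mapping_eqI) (simp add: lookup_cartier assms subst_pow_def)
next
  case (2 e)
  then show ?case
    by (intro poly_mapping_eqI)
      (simp only: lookup_cartier assms subst_pow_frag_of lookup_frag_of_mult vector_ssub_ldistrib)
next
  case (3 A A')
  then show ?case
    by (simp add: poly_mapping_eq_iff fun_eq_iff lookup_cartier assms subst_pow_diff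
        left_diff_distrib lookup_minus)
qed

text \<open>Dividing the degree by \<open>q\<close> compensates for the growth of powers of
  \<open>P\<close> along long blocks, so one degree bound serves at every scale.\<close>

lemma keys_cartier_box:
  assumes "q > 0" "Poly_Mapping.keys A \<subseteq> box D"
  shows "Poly_Mapping.keys (cartier q A) \<subseteq> box (D div q)"
proof
  fix e assume "e \<in> Poly_Mapping.keys (cartier q A)"
  then have "int q *s e \<in> box D"
    using assms by (auto simp: in_keys_iff lookup_cartier)
  then have "int q * \<bar>e $ i\<bar> \<le> int D" for i
    by (auto simp: box_def abs_mult)
  then have "int (nat \<bar>e $ i\<bar> * q) \<le> int D" for i
    by (simp add: mult.commute)
  then have "nat \<bar>e $ i\<bar> * q \<le> D" for i
    by (simp only: of_nat_le_iff)
  then have "nat \<bar>e $ i\<bar> \<le> D div q" for i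
    using assms(1) by (simp add: less_eq_div_iff_mult_less_eq)
  then show "e \<in> box (D div q)" by (simp add: box_def nat_le_iff)
qed

text \<open>For \<open>D < q\<close> the only vector in \<open>box D\<close> divisible by
  \<open>q\<close> is \<open>0\<close>, so \<open>cartier q B\<close> is the constant
  \<open>ct B\<close>.\<close>

lemma ct_mult_cartier_small:
  assumes "Poly_Mapping.keys B \<subseteq> box D" "D < q"
  shows "ct (A * cartier q B) = ct A * ct B"
proof -
  have "Poly_Mapping.keys (cartier q B) \<subseteq> box 0"
    using keys_cartier_box[OF _ assms(1), of q] assms(2) by simp
  then have 0: "Poly_Mapping.keys (cartier q B) \<subseteq> {0}"
    by (auto simp: box_def vec_eq_iff)
  have "cartier q B = frag_cmul (ct B) (frag_of 0)"
  proof (rule poly_mapping_eqI)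
    fix e
    show "Poly_Mapping.lookup (cartier q B) e = Poly_Mapping.lookup (frag_cmul (ct B) (frag_of 0)) e"
    proof (cases "e = 0")
      case True
      then show ?thesis using ct_cartier[of q B] assms(2) by (simp add: ct_def)
    next
      case False
      then have "e \<notin> Poly_Mapping.keys (cartier q B)" using 0 by auto
      then show ?thesis using False by (simp add: in_keys_iff lookup_one)
    qed
  qed
  then have "A * cartier q B = frag_cmul (ct B) A" by (simp add: frag_cmul_eq mult.commute)
  then show ?thesis by (simp add: ct_def)
qed

subsection \<open>Recurrence and frequency of sequences\<close>

lemma finite_range_bounded_witness:
  fixes Q :: "'a \<Rightarrow> nat \<Rightarrow> bool"
  assumes "finite (range f)" and "\<And>n. \<exists>w. Q (f n) w"
  shows "\<exists>W. \<forall>n. \<exists>w\<le>W. Q (f n) w"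
proof -
  let ?g = "\<lambda>x. LEAST w. Q x w"
  have "\<exists>w\<le>Max (?g ` range f). Q (f n) w" for n
  proof -
  have "Q (f n) (?g (f n))" using assms(2) by (rule LeastI_ex)
  moreover have "?g (f n) \<le> Max (?g ` range f)" using assms(1) by (intro Max_ge) auto
  ultimately show ?thesis by blast
  qed
  then show ?thesis by blast
qed

lemma occurs_at_iff: "occurs_at s w i \<longleftrightarrow> (\<forall>x<length w. s (i + x) = w ! x)"
  unfolding occurs_at_def by (subst list_eq_iff_nth_eq) simp

text \<open>A word of length \<open>l \<le> N\<close> starting in block \<open>m\<close> of length
  \<open>N\<close> fits in the blocks \<open>m\<close> and \<open>m + 1\<close>, so it recurs with
  this pair. The shift is at most \<open>C * N \<le> C * c * l\<close>, with \<open>c\<close> and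
  \<open>C\<close> independent of \<open>l\<close>.\<close>

lemma linearly_recurrentI:
  assumes "\<And>l. l > 0 \<Longrightarrow> \<exists>N. l \<le> N \<and> N \<le> c * l \<and>
      (\<forall>m. \<exists>m'. m < m' \<and> m' \<le> m + C \<and> (\<forall>x<2 * N. s (m' * N + x) = s (m * N + x)))"
  shows "linearly_recurrent s"
proof -
  have rec: "recurs_within s w (C * c * length w)" if "w \<in> factors s" for w
    unfolding recurs_within_def
  proof (intro allI impI)
    fix i assume i: "occurs_at s w i"
    have "length w > 0" using that by (simp add: factors_def)
    then obtain N where N: "length w \<le> N" "N \<le> c * length w"
      and ex: "\<And>m. \<exists>m'. m < m' \<and> m' \<le> m + C \<and> (\<forall>x<2 * N. s (m' * N + x) = s (m * N + x))"
      using assms by meson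
    have "N > 0" using N(1) \<open>length w > 0\<close> by linarith
    define m r where "m = i div N" and "r = i mod N"
    have imr: "i = m * N + r" and "r < N" using \<open>N > 0\<close> by (auto simp: m_def r_def)
    obtain m' where m': "m < m'" "m' \<le> m + C"
      and eq: "\<And>x. x < 2 * N \<Longrightarrow> s (m' * N + x) = s (m * N + x)"
      using ex by blast
    have "occurs_at s w (m' * N + r)"
      unfolding occurs_at_iff
    proof (intro allI impI)
      fix x assume "x < length w"
      then have "s (m' * N + r + x) = s (i + x)"
        using eq[of "r + x"] \<open>r < N\<close> N(1) by (simp add: imr add.assoc)
      then show "s (m' * N + r + x) = w ! x"
        using i \<open>x < length w\<close> by (simp add: occurs_at_iff)
    qed
    moreover have "i < m' * N + r"
      using m'(1) \<open>N > 0\<close> by (simp add: imr)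
    moreover have "m' * N + r \<le> i + C * c * length w"
    proof -
      have "m' * N \<le> (m + C) * N" using m'(2) by simp
      also have "\<dots> \<le> m * N + C * (c * length w)"
        using N(2) by (simp add: distrib_right)
      finally show ?thesis by (simp add: imr mult.assoc)
    qed
    ultimately show "\<exists>j. i < j \<and> j \<le> i + C * c * length w \<and> occurs_at s w j" by blast
  qed
  then have "uniformly_recurrent s" by (auto simp: uniformly_recurrent_def)
  with rec show ?thesis unfolding linearly_recurrent_def by blast
qed

section \<open>Frequency one and recurrence\<close>

lemma has_frequency_iff_other:
  "has_frequency s z 1 \<longleftrightarrow> (\<lambda>N. real (card {n. n < N \<and> s n \<noteq> z}) / real N) \<longlonglongrightarrow> 0"
proof -
  let ?A = "\<lambda>N. real (card {n. n < N \<and> s n = z}) / real N"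
  let ?B = "\<lambda>N. real (card {n. n < N \<and> s n \<noteq> z}) / real N"
  \<comment> \<open>At \<open>N = 0\<close> both quotients are \<open>0\<close> by the convention
    for division.\<close>
  have AB: "?A N + ?B N = 1" if "N > 0" for N
  proof -
    have "{..<N} = {n. n < N \<and> s n = z} \<union> {n. n < N \<and> s n \<noteq> z}" by auto
    then have "card {..<N} = card {n. n < N \<and> s n = z} + card {n. n < N \<and> s n \<noteq> z}"
      by (metis (no_types, lifting) card_Un_disjoint disjoint_iff finite_Un finite_lessThan mem_Collect_eq)
    then have "real N = real (card {n. n < N \<and> s n = z}) + real (card {n. n < N \<and> s n \<noteq> z})"
      by simp
    then show ?thesis using that by (simp flip: add_divide_distrib)
  qed
  have "?A \<longlonglongrightarrow> 1 \<longleftrightarrow> (\<lambda>N. 1 - ?B N) \<longlonglongrightarrow> 1"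
  proof (rule filterlim_cong[OF refl refl])
    show "\<forall>\<^sub>F N in sequentially. ?A N = 1 - ?B N"
      using eventually_gt_at_top[of 0] by eventually_elim (use AB in \<open>simp add: eq_diff_eq\<close>)
  qed
  also have "\<dots> \<longleftrightarrow> ?B \<longlonglongrightarrow> 0"
  proof
    assume "(\<lambda>N. 1 - ?B N) \<longlonglongrightarrow> 1"
    from tendsto_diff[OF tendsto_const[of 1] this] show "?B \<longlonglongrightarrow> 0" by simp
  next
    assume "?B \<longlonglongrightarrow> 0"
    from tendsto_diff[OF tendsto_const[of 1] this] show "(\<lambda>N. 1 - ?B N) \<longlonglongrightarrow> 1" by simp
  qed
  finally show ?thesis by (simp add: has_frequency_def)
qed

text \<open>Recurrence of the one-letter word \<open>[s n0]\<close> bounds its gaps by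
  \<open>C\<close>, which would give the values other than \<open>z\<close> a positive lower
  density.\<close>

lemma not_uniformly_recurrent_if_frequency_1:
  assumes freq: "has_frequency s z 1" and n0: "s n0 \<noteq> z"
  shows "\<not> uniformly_recurrent s"
proof
  assume "uniformly_recurrent s"
  moreover have "[s n0] \<in> factors s" by (auto simp: factors_def occurs_at_def)
  ultimately obtain C where "recurs_within s [s n0] C" by (auto simp: uniformly_recurrent_def)
  then have rec: "\<exists>j. i < j \<and> j \<le> i + C \<and> s j = s n0" if "s i = s n0" for i
    using that by (simp add: recurs_within_def occurs_at_def)
  have many: "k \<le> card {n. n < n0 + k * C + 1 \<and> s n \<noteq> z}" for k
  proof -
    have "\<exists>T j. finite T \<and> card T = k \<and> j \<le> n0 + k * C \<and> s j = s n0 \<and> (\<forall>n\<in>T. n \<le> j \<and> s n = s n0)"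
    proof (induction k)
      case 0
      then show ?case by (intro exI[of _ "{}"] exI[of _ n0]) auto
    next
      case (Suc k)
      then obtain T j where T: "finite T" "card T = k" "j \<le> n0 + k * C" "s j = s n0"
        "\<forall>n\<in>T. n \<le> j \<and> s n = s n0" by blast
      obtain j' where j': "j < j'" "j' \<le> j + C" "s j' = s n0" using rec[OF T(4)] by blast
      have "j' \<notin> T" using T(5) j'(1) by auto
      then show ?case using T j' by (intro exI[of _ "insert j' T"] exI[of _ j']) auto
    qed
    then obtain T j where "finite T" "card T = k" "j \<le> n0 + k * C" "\<forall>n\<in>T. n \<le> j \<and> s n = s n0"
      by blast
    then have "T \<subseteq> {n. n < n0 + k * C + 1 \<and> s n \<noteq> z}" using n0 by force
    then show ?thesis using \<open>card T = k\<close> card_mono[of "{n. n < n0 + k * C + 1 \<and> s n \<noteq> z}" T] by simp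
  qed
  let ?B = "\<lambda>N. real (card {n. n < N \<and> s n \<noteq> z}) / real N"
  \<comment> \<open>Half of the lower bound \<open>1 / (n0 + C + 1)\<close> for
    \<open>k / (n0 + k * C + 1)\<close>, valid for \<open>k \<ge> 1\<close>.\<close>
  define e where "e = 1 / (2 * (real n0 + real C + 1))"
  have "e > 0" by (simp add: e_def add_nonneg_pos)
  then obtain K where K: "\<And>N. N \<ge> K \<Longrightarrow> ?B N < e"
    using freq[unfolded has_frequency_iff_other] by (auto simp: LIMSEQ_iff)
  have "C > 0" using rec[of n0] by (cases C) auto
  define k where "k = Suc K"
  define N where "N = n0 + k * C + 1"
  have "N \<ge> K" using \<open>C > 0\<close> by (cases C) (auto simp: N_def k_def)
  have "N > 0" by (simp add: N_def)
  then have "real N > 0" by simp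
  have "real k / real N \<le> ?B N"
    using many[of k] \<open>real N > 0\<close> by (simp add: N_def divide_right_mono)
  then have "real k / real N < e" using K[OF \<open>N \<ge> K\<close>] by linarith
  then have "real k < e * real N" using \<open>real N > 0\<close> by (simp add: divide_less_eq)
  also have "real N \<le> real k * (real n0 + real C + 1)"
  proof -
    have "n0 + k * C + 1 \<le> k * n0 + k * C + k" by (simp add: k_def)
    then have "N \<le> k * (n0 + C + 1)" by (simp add: N_def distrib_left)
    then have "real N \<le> real (k * (n0 + C + 1))" by (rule of_nat_mono)
    then show ?thesis by (simp add: algebra_simps)
  qed
  then have "e * real N \<le> real k / 2"
    using mult_left_mono[of "real N" "real k * (real n0 + real C + 1)" e] \<open>e > 0\<close>
    by (simp add: e_def field_simps)
  finally show False by simp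
qed

section \<open>Numbers with few occurrences of a given digit\<close>

text \<open>Leading zeros are not counted, so the count is meaningful for \<open>g > 0\<close> only.\<close>

function digit_count :: "nat \<Rightarrow> nat \<Rightarrow> nat \<Rightarrow> nat" where
  "digit_count b g n = (if n = 0 \<or> b \<le> 1 then 0
     else digit_count b g (n div b) + of_bool (n mod b = g))"
  by auto
termination by (relation "measure (\<lambda>(b, g, n). n)") auto

declare digit_count.simps [simp del]

lemma digit_count_step:
  assumes "0 < g" "g < b" "r < b"
  shows "digit_count b g (n * b + r) = digit_count b g n + of_bool (r = g)"
proof (cases "n * b + r = 0")
  case True
  then show ?thesis using assms by (auto simp: digit_count.simps)
next
  case False
  then show ?thesis using assms by (subst digit_count.simps) auto
qed

text \<open>The split is at the least significant digit \<open>g\<close>: all its other occurrences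
  lie in the higher digits \<open>u\<close>.\<close>

lemma digit_count_decompose:
  assumes "0 < g" "g < b" "digit_count b g n > 0"
  shows "\<exists>u i t. t < b ^ i \<and> n = u * b ^ Suc i + g * b ^ i + t \<and>
    digit_count b g n = Suc (digit_count b g u)"
  using assms(3)
proof (induction n rule: less_induct)
  case (less n)
  have b: "b > 0" "b > 1" using assms(1,2) by auto
  have n: "n = n div b * b + n mod b" by simp
  have dc: "digit_count b g n = digit_count b g (n div b) + of_bool (n mod b = g)"
    using digit_count_step[OF assms(1,2), of "n mod b" "n div b"] b by simp
  show ?case
  proof (cases "n mod b = g")
    case True
    then show ?thesis
      using dc n by (intro exI[of _ "n div b"] exI[of _ 0]) auto
  next
    case False
    then have pos: "digit_count b g (n div b) > 0" using less.prems dc by simp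
    have "n > 0" using less.prems by (cases n) (auto simp: digit_count.simps)
    then have "n div b < n" using b by simp
    from less.IH[OF this pos] obtain u i t where
      *: "t < b ^ i" "n div b = u * b ^ Suc i + g * b ^ i + t"
        "digit_count b g (n div b) = Suc (digit_count b g u)" by blast
    have "t * b + n mod b < b ^ Suc i"
    proof -
      have "t * b + n mod b < (t + 1) * b" using b by simp
      also have "\<dots> \<le> b ^ i * b" using *(1) by (intro mult_le_mono1) simp
      finally show ?thesis by (simp add: mult.commute)
    qed
    moreover have "n = u * b ^ Suc (Suc i) + g * b ^ Suc i + (t * b + n mod b)"
      using n unfolding *(2) by (simp add: algebra_simps)
    ultimately show ?thesis using *(3) dc False by (metis add.right_neutral of_bool_eq(1))
  qed
qed

text \<open>The weight \<open>2\<close> to the power \<open>- digit_count b g n\<close> is a product over the digits of \<open>n\<close>.\<close>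

lemma sum_digit_count_weight:
  assumes "0 < g" "g < b"
  shows "(\<Sum>n<b ^ i. (1/2::real) ^ digit_count b g n) = (real b - 1/2) ^ i"
proof (induction i)
  case 0
  then show ?case by (simp add: digit_count.simps)
next
  case (Suc i)
  let ?f = "\<lambda>n. (1/2::real) ^ digit_count b g n"
  have block: "sum ?f {n * b..<n * b + b} = ?f n * (real b - 1/2)" for n
  proof -
    have "sum ?f {n * b..<n * b + b} = (\<Sum>r<b. ?f (n * b + r))"
      using sum.shift_bounds_nat_ivl[of ?f 0 "n * b" b]
      by (simp add: add.commute lessThan_atLeast0)
    also have "\<dots> = (\<Sum>r<b. ?f n * (1 - (if r = g then 1/2 else 0)))"
      by (rule sum.cong) (auto simp: digit_count_step[OF assms])
    also have "\<dots> = ?f n * (real b - 1/2)"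
      using assms by (simp add: sum_subtractf flip: sum_distrib_left)
    finally show ?thesis .
  qed
  have "(\<Sum>n<b ^ Suc i. ?f n) = (\<Sum>n<b ^ i. sum ?f {n * b..<n * b + b})"
    by (simp add: sum.nat_group mult.commute)
  also have "\<dots> = (\<Sum>n<b ^ i. ?f n) * (real b - 1/2)"
    by (simp only: block sum_distrib_right)
  finally show ?case by (simp add: Suc)
qed

text \<open>Markov's inequality: each number counted has weight at least \<open>(1/2) ^ c\<close>,
  and the total weight is known.\<close>

lemma card_digit_count_less:
  assumes "0 < g" "g < b"
  shows "real (card {n. n < b ^ i \<and> digit_count b g n < c}) \<le> 2 ^ c * (real b - 1/2) ^ i"
proof -
  let ?T = "{n. n < b ^ i \<and> digit_count b g n < c}"
  have "real (card ?T) * (1/2) ^ c = (\<Sum>n\<in>?T. (1/2) ^ c)" by simp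
  also have "\<dots> \<le> (\<Sum>n\<in>?T. (1/2::real) ^ digit_count b g n)"
    by (intro sum_mono power_decreasing) auto
  also have "\<dots> \<le> (\<Sum>n<b ^ i. (1/2::real) ^ digit_count b g n)"
    by (rule sum_mono2) auto
  finally have "real (card ?T) * (1/2) ^ c \<le> (real b - 1/2) ^ i"
    by (simp add: sum_digit_count_weight[OF assms])
  then show ?thesis by (simp add: power_divide field_simps)
qed

text \<open>Below \<open>b ^ i\<close> the share of numbers with fewer than \<open>c\<close> digits
  \<open>g\<close> is at most \<open>2 ^ c * \<theta> ^ i\<close> with
  \<open>\<theta> < 1\<close>.\<close>

lemma has_frequency_1_if_digit_count:
  assumes g: "0 < g" "g < b" and "S > 0"
    and s: "\<And>n. s n \<noteq> z \<Longrightarrow> digit_count b g (n div S) < c"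
  shows "has_frequency s z 1"
  unfolding has_frequency_iff_other
proof (rule LIMSEQ_I)
  fix r :: real assume "r > 0"
  let ?B = "\<lambda>N. card {n. n < N \<and> s n \<noteq> z}"
  define \<theta> where "\<theta> = (real b - 1/2) / real b"
  \<comment> \<open>\<open>K\<close> collects the \<open>S\<close> remainders, the constant
    \<open>2 ^ c\<close> and the factor \<open>b\<close> lost in enclosing \<open>N\<close> between
    \<open>b ^ i\<close> and \<open>b ^ (i + 1)\<close>.\<close>
  define K where "K = real S * 2 ^ c * real b"
  have b: "b \<ge> 2" using g by simp
  have \<theta>: "0 < \<theta>" "\<theta> < 1" using b by (auto simp: \<theta>_def field_simps)
  have K: "K > 0" using \<open>S > 0\<close> b by (simp add: K_def)
  obtain I where I: "\<theta> ^ I < r / K"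
    using real_arch_pow_inv[of "r / K" \<theta>] \<open>r > 0\<close> K \<theta> by auto
  have "real (?B N) / real N < r" if "N \<ge> b ^ I" for N
  proof -
    have "N \<ge> 1" using that b one_le_power[of b I] by linarith
    then obtain i where i: "b ^ i \<le> N" "N < b ^ (i + 1)"
      using ex_power_ivl1[OF b] by blast
    have "b ^ I < b ^ (i + 1)" using that i by linarith
    then have "I < i + 1" by (rule power_less_imp_less_exp[rotated]) (use b in simp)
    then have "I \<le> i" by simp
    let ?T = "{n. n < b ^ (i + 1) \<and> digit_count b g n < c}"
    have "{n. n < N \<and> s n \<noteq> z} \<subseteq> (\<lambda>(n, r). n * S + r) ` (?T \<times> {..<S})"
    proof
      fix n assume "n \<in> {n. n < N \<and> s n \<noteq> z}"
      then have n: "n < N" "s n \<noteq> z" by auto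
      have "n div S < b ^ (i + 1)" using n(1) i(2) div_le_dividend[of n S] by linarith
      then have "(n div S, n mod S) \<in> ?T \<times> {..<S}" using s[OF n(2)] \<open>S > 0\<close> by simp
      then show "n \<in> (\<lambda>(n, r). n * S + r) ` (?T \<times> {..<S})"
        by (rule rev_image_eqI) simp
    qed
    then have "?B N \<le> card ((\<lambda>(n, r). n * S + r) ` (?T \<times> {..<S}))"
      by (intro card_mono) auto
    also have "\<dots> \<le> card ?T * S"
      by (rule order_trans[OF card_image_le]) (auto simp: card_cartesian_product)
    finally have "real (?B N) \<le> real (card ?T) * real S"
      by (simp flip: of_nat_mult)
    also have "\<dots> \<le> (2 ^ c * (real b - 1/2) ^ (i + 1)) * real S"
      by (intro mult_right_mono card_digit_count_less g) simp
    also have "\<dots> = K * \<theta> ^ (i + 1) * real b ^ i"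
      using b by (simp add: K_def \<theta>_def power_divide)
    finally have "real (?B N) \<le> K * \<theta> ^ (i + 1) * real b ^ i" .
    then have "real (?B N) / real N \<le> K * \<theta> ^ (i + 1) * real b ^ i / real N"
      by (rule divide_right_mono) simp
    also have "\<dots> \<le> K * \<theta> ^ (i + 1) * real N / real N"
    proof (intro divide_right_mono mult_left_mono)
      show "real b ^ i \<le> real N" using i(1) by (simp flip: of_nat_power)
    qed (use K \<theta> in auto)
    also have "\<dots> = K * \<theta> ^ (i + 1)" using \<open>N \<ge> 1\<close> by simp
    also have "\<dots> \<le> K * \<theta> ^ I"
      using K \<theta> \<open>I \<le> i\<close> by (intro mult_left_mono power_decreasing) auto
    also have "\<dots> < r" using I K by (simp add: field_simps)
    finally show ?thesis .
  qed
  then show "\<exists>no. \<forall>N\<ge>no. norm (real (?B N) / real N - 0) < r" by auto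
qed

subsection \<open>Constant terms of powers\<close>

lemma ex_less_power: "2 \<le> p \<Longrightarrow> \<exists>k. x < (p::nat) ^ k"
  using less_le_trans[OF less_exp[of x] power_mono[of 2 p x]] by auto

lemma ct_subst_pow:
  assumes "q > 0"
  shows "ct (subst_pow q A) = ct A"
proof -
  have "ct (subst_pow q A) = ct (cartier q (subst_pow q A * 1))"
    using assms by (simp add: ct_cartier)
  also have "\<dots> = ct (A * cartier q 1)"
    by (simp only: cartier_subst_pow_mult[OF assms])
  also have "\<dots> = ct A"
    using ct_mult_cartier_small[of 1 0 q A] assms by (simp add: box_def)
  finally show ?thesis .
qed

text \<open>Euler's theorem. The inverse is wanted as a power because powers of values
  \<open>ct (R ^ n)\<close> will again be such values modulo \<open>p ^ a\<close>.\<close>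

lemma coprime_ex_inverse_power:
  fixes x :: int
  assumes "coprime x (int m)" "m > 0"
  shows "\<exists>k. [x * x ^ k = 1] (mod int m)"
proof -
  define y where "y = nat (x mod int m)"
  have xy: "[x = int y] (mod int m)"
    using assms(2) by (simp add: y_def cong_def)
  have "coprime (int y) (int m)"
    using assms(1) xy by (metis cong_imp_coprime)
  then have "[y ^ totient m = 1] (mod m)"
    by (intro euler_theorem) simp
  then have "[int y ^ totient m = 1] (mod int m)"
    by (metis cong_int_iff of_nat_1 of_nat_power)
  moreover have "[x ^ totient m = int y ^ totient m] (mod int m)"
    using xy by (rule cong_pow)
  moreover have "totient m = Suc (totient m - 1)"
    using assms(2) by simp
  ultimately have "[x ^ Suc (totient m - 1) = 1] (mod int m)"
    using cong_trans by metis
  then show ?thesis by auto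
qed

locale prime_power_ct =
  fixes P :: "'r::finite laurent" and p a :: nat
  assumes prime: "prime p" and a_pos: "a \<ge> 1"
begin

definition R :: "'r laurent" where "R = P ^ p ^ (a - 1)"

lemma p_ge_2: "p \<ge> 2"
  using prime by (rule prime_ge_2_nat)

lemma keys_R_power: "Poly_Mapping.keys (R ^ n) \<subseteq> box (n * laurent_deg R)"
  by (intro keys_power_box keys_box_laurent_deg)

lemma ct_R_split:
  "[ct (R ^ (u * p ^ k) * B) = ct (R ^ u * cartier (p ^ k) B)] (mod int (p ^ a))"
proof -
  have q: "p ^ k > 0" using p_ge_2 by simp
  have "pcong (p ^ a) ((R ^ p ^ k) ^ u) (subst_pow (p ^ k) R ^ u)"
    unfolding R_def by (intro pcong_power frobenius_prime_power prime a_pos)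
  then have "pcong (p ^ a) (R ^ (u * p ^ k)) (subst_pow (p ^ k) (R ^ u))"
    by (simp add: subst_pow_power mult.commute flip: power_mult)
  then have "[ct (R ^ (u * p ^ k) * B) = ct (subst_pow (p ^ k) (R ^ u) * B)] (mod int (p ^ a))"
    by (intro pcong_ct pcong_mult) auto
  also have "ct (subst_pow (p ^ k) (R ^ u) * B) = ct (R ^ u * cartier (p ^ k) B)"
    by (metis q ct_cartier cartier_subst_pow_mult)
  finally show ?thesis .
qed

lemma ct_R_split_small:
  assumes "Poly_Mapping.keys B \<subseteq> box D" "D < p ^ k"
  shows "[ct (R ^ (u * p ^ k) * B) = ct (R ^ u) * ct B] (mod int (p ^ a))"
  using ct_R_split[of u k B] by (simp add: ct_mult_cartier_small[OF assms])

lemma P_power_split: "P ^ (u * p ^ (a - 1) + x) * Q = R ^ u * (P ^ x * Q)"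
  by (simp add: R_def power_add mult.assoc mult.commute[of u] flip: power_mult)

text \<open>Modulo \<open>p\<close> the Frobenius congruence holds for \<open>P ^ n\<close> itself,
  and the substitution keeps constant terms. This transfers divisibility by \<open>p\<close> between
  \<open>P\<close> and \<open>R\<close>.\<close>

lemma ct_R_power_cong: "[ct (R ^ n) = ct (P ^ n)] (mod int p)"
proof -
  have "pcong (p ^ 1) ((P ^ n) ^ p ^ (a - 1)) (subst_pow (p ^ (a - 1)) (P ^ n))"
    using frobenius_prime_power[OF prime order_refl, of "P ^ n" "a - 1"] by simp
  from pcong_ct[OF this] show ?thesis
    using p_ge_2 by (simp add: ct_subst_pow R_def mult.commute flip: power_mult)
qed

lemma p_dvd_ct_R_power_iff: "int p dvd ct (R ^ n) \<longleftrightarrow> int p dvd ct (P ^ n)"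
  using ct_R_power_cong by (rule cong_dvd_iff)

lemma ct_R_power_mult:
  assumes "w * laurent_deg R < p ^ k"
  shows "[ct (R ^ (u * p ^ k + w)) = ct (R ^ u) * ct (R ^ w)] (mod int (p ^ a))"
  using ct_R_split_small[OF keys_R_power assms] by (simp add: power_add)

section \<open>Powers whose constant terms are never divisible by \<open>p\<close>\<close>

context
  assumes unit: "\<And>n. \<not> int p dvd ct (P ^ n)"
begin

text \<open>The values are units modulo \<open>p ^ a\<close>. Concatenating digits across a gap of
  zeros multiplies them, so their powers, hence their inverses, are also values.\<close>

lemma ex_inverse: "\<exists>w. [ct (R ^ n) * ct (R ^ w) = 1] (mod int (p ^ a))"
proof -
  have powers: "\<exists>w. [ct (R ^ w) = ct (R ^ n) ^ k] (mod int (p ^ a))" for k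
  proof (induction k)
    case 0
    then show ?case by (intro exI[of _ 0]) simp
  next
    case (Suc k)
    then obtain w where w: "[ct (R ^ w) = ct (R ^ n) ^ k] (mod int (p ^ a))" by blast
    obtain j where "w * laurent_deg R < p ^ j" using ex_less_power p_ge_2 by blast
    from cong_trans[OF ct_R_power_mult[OF this] cong_mult[OF cong_refl w]]
    show ?case by auto
  qed
  have "coprime (int p) (ct (R ^ n))"
    using unit[of n] prime by (intro prime_imp_coprime) (auto simp: p_dvd_ct_R_power_iff)
  then have "coprime (ct (R ^ n)) (int (p ^ a))"
    by (simp add: coprime_commute)
  then obtain k where k: "[ct (R ^ n) * ct (R ^ n) ^ k = 1] (mod int (p ^ a))"
    using coprime_ex_inverse_power p_ge_2 by (metis neq0_conv not_numeral_le_zero zero_less_power)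
  obtain w where "[ct (R ^ w) = ct (R ^ n) ^ k] (mod int (p ^ a))" using powers by blast
  from cong_trans[OF cong_mult[OF cong_refl this] k] show ?thesis by blast
qed

text \<open>An exponent \<open>w\<close> with value inverse to \<open>ct (R ^ v)\<close> can be
  chosen by the residue alone, hence bounded uniformly in \<open>v\<close>; it is appended to the
  digits of \<open>v\<close>.\<close>

lemma ex_ct_R_eq_1_in_block:
  "\<exists>k. \<forall>v. \<exists>w<p ^ k. [ct (R ^ (v * p ^ k + w)) = 1] (mod int (p ^ a))"
proof -
  let ?M = "int (p ^ a)"
  have M: "?M > 0" using p_ge_2 by simp
  have "range (\<lambda>n. ct (R ^ n) mod ?M) \<subseteq> {0..<?M}" using M by auto
  then have "finite (range (\<lambda>n. ct (R ^ n) mod ?M))" by (rule finite_subset) simp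
  moreover have "\<exists>w. [ct (R ^ n) mod ?M * ct (R ^ w) = 1] (mod ?M)" for n
    using ex_inverse[of n] by (simp add: cong_def mod_mult_left_eq)
  ultimately have "\<exists>W. \<forall>n. \<exists>w\<le>W. [ct (R ^ n) mod ?M * ct (R ^ w) = 1] (mod ?M)"
    by (rule finite_range_bounded_witness[where Q = "\<lambda>x w. [x * ct (R ^ w) = 1] (mod ?M)"])
  then obtain W where W: "\<And>n. \<exists>w\<le>W. [ct (R ^ n) mod ?M * ct (R ^ w) = 1] (mod ?M)" by blast
  obtain k where k: "W * (laurent_deg R + 1) < p ^ k" using ex_less_power p_ge_2 by blast
  have "\<exists>w<p ^ k. [ct (R ^ (v * p ^ k + w)) = 1] (mod ?M)" for v
  proof -
    obtain w where w: "w \<le> W" "[ct (R ^ v) mod ?M * ct (R ^ w) = 1] (mod ?M)" using W by blast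
    have "w * (laurent_deg R + 1) < p ^ k" using w(1) k by (meson le_less_trans mult_le_mono1)
    then have "w * laurent_deg R < p ^ k" "w < p ^ k" by auto
    moreover have "[ct (R ^ v) * ct (R ^ w) = 1] (mod ?M)"
      using w(2) by (simp add: cong_def mod_mult_left_eq)
    ultimately show ?thesis using cong_trans[OF ct_R_power_mult] by blast
  qed
  then show ?thesis by blast
qed

text \<open>The coefficients of \<open>R ^ m\<close> and \<open>R ^ (m + 1)\<close> in
  \<open>box D\<close> take finitely many values modulo \<open>p ^ a\<close>, so some
  \<open>m0 \<le> H\<close> already has them. Digits \<open>u\<close> with \<open>ct (R ^ u)\<close>
  congruent to \<open>1\<close> in front of \<open>m0\<close> preserve them, and such
  \<open>u\<close> occur with bounded gaps. The shift \<open>e\<close> serves words that straddle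
  two blocks.\<close>

lemma ct_R_window_recurs:
  "\<exists>C. \<forall>m. \<exists>m'. m < m' \<and> m' \<le> m + C \<and>
     (\<forall>A e. Poly_Mapping.keys A \<subseteq> box D \<and> e \<le> 1 \<longrightarrow>
       [ct (R ^ (m' + e) * A) = ct (R ^ (m + e) * A)] (mod int (p ^ a)))"
proof -
  let ?M = "int (p ^ a)"
  have M: "?M > 0" using p_ge_2 by simp
  define win where
    "win m = (\<lambda>x\<in>box D. Poly_Mapping.lookup (R ^ m) x mod ?M)" for m
  define win2 where "win2 m = (win m, win (Suc m))" for m
  have "win m \<in> box D \<rightarrow>\<^sub>E {0..<?M}" for m
    using M by (auto simp: win_def)
  then have "range win2 \<subseteq> (box D \<rightarrow>\<^sub>E {0..<?M}) \<times> (box D \<rightarrow>\<^sub>E {0..<?M})"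
    by (auto simp: win2_def)
  then have fin: "finite (range win2)"
    by (rule finite_subset) (intro finite_cartesian_product finite_PiE finite_box, auto)
  have "\<exists>H. \<forall>m. \<exists>m0\<le>H. win2 m0 = win2 m"
    using finite_range_bounded_witness[OF fin, of "\<lambda>y m0. win2 m0 = y"] by auto
  then obtain H where H: "\<And>m. \<exists>m0\<le>H. win2 m0 = win2 m" by blast
  obtain k where k: "\<And>v. \<exists>w<p ^ k. [ct (R ^ (v * p ^ k + w)) = 1] (mod ?M)"
    using ex_ct_R_eq_1_in_block by blast
  \<comment> \<open>Enough room for the degree of \<open>R ^ (m0 + e) * A\<close> with
    \<open>e \<le> 1\<close>, and for \<open>m0 < p ^ h\<close>.\<close>
  obtain h where h: "(H + 1) * (laurent_deg R + 1) + D < p ^ h" using ex_less_power p_ge_2 by blast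
  show ?thesis
  proof (rule exI[of _ "2 * (p ^ k * p ^ h)"], rule allI)
    fix m
    obtain m0 where m0: "m0 \<le> H" "win2 m0 = win2 m" using H by blast
    \<comment> \<open>The block after the one containing \<open>m\<close>, so that
      \<open>m' > m\<close>.\<close>
    define v where "v = m div (p ^ k * p ^ h) + 1"
    obtain w where w: "w < p ^ k" "[ct (R ^ (v * p ^ k + w)) = 1] (mod ?M)" using k by blast
    define u where "u = v * p ^ k + w"
    define m' where "m' = u * p ^ h + m0"
    have pos: "p ^ k * p ^ h > 0" using p_ge_2 by simp
    have "m < v * (p ^ k * p ^ h)"
      using dividend_less_div_times[OF pos, of m] by (simp add: v_def)
    also have "\<dots> \<le> m'" by (simp add: m'_def u_def algebra_simps)
    finally have "m < m'" .
    moreover have "m' \<le> m + 2 * (p ^ k * p ^ h)"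
    proof -
      have "m0 < p ^ h" using m0(1) h by simp
      then have "m' \<le> (u + 1) * p ^ h" by (simp add: m'_def)
      also have "\<dots> \<le> ((v + 1) * p ^ k) * p ^ h"
        using w(1) by (intro mult_le_mono1) (simp add: u_def)
      also have "\<dots> = m div (p ^ k * p ^ h) * (p ^ k * p ^ h) + 2 * (p ^ k * p ^ h)"
        by (simp add: v_def algebra_simps)
      also have "\<dots> \<le> m + 2 * (p ^ k * p ^ h)" by simp
      finally show ?thesis .
    qed
    moreover have "[ct (R ^ (m' + e) * A) = ct (R ^ (m + e) * A)] (mod ?M)"
      if A: "Poly_Mapping.keys A \<subseteq> box D" and e: "e \<le> 1" for A and e :: nat
    proof -
      have "(m0 + e) * laurent_deg R + D \<le> (H + 1) * (laurent_deg R + 1) + D"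
        using m0(1) e by (intro add_mono mult_mono) auto
      then have small: "(m0 + e) * laurent_deg R + D < p ^ h" using h by linarith
      have "[ct (R ^ (u * p ^ h) * (R ^ (m0 + e) * A)) = ct (R ^ u) * ct (R ^ (m0 + e) * A)] (mod ?M)"
        by (rule ct_R_split_small[OF keys_mult_box[OF keys_R_power A] small])
      then have "[ct (R ^ (m' + e) * A) = ct (R ^ u) * ct (R ^ (m0 + e) * A)] (mod ?M)"
        by (simp add: m'_def power_add mult.assoc)
      also have "[ct (R ^ u) * ct (R ^ (m0 + e) * A) = 1 * ct (R ^ (m0 + e) * A)] (mod ?M)"
        using w(2) by (intro cong_mult) (auto simp: u_def)
      also have "[1 * ct (R ^ (m0 + e) * A) = ct (R ^ (m + e) * A)] (mod ?M)"
      proof -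
        have "win (m0 + e) = win (m + e)"
          using m0(2) e by (cases e) (auto simp: win2_def)
        then have "Poly_Mapping.lookup (R ^ (m0 + e)) x mod ?M = Poly_Mapping.lookup (R ^ (m + e)) x mod ?M"
          if "x \<in> box D" for x
          using that by (auto simp: win_def dest: fun_cong[of _ _ x])
        then show ?thesis
          using ct_mult_cong[OF A, of "R ^ (m0 + e)" "R ^ (m + e)" ?M] by (simp add: cong_def)
      qed
      finally show ?thesis .
    qed
    ultimately show "\<exists>m'. m < m' \<and> m' \<le> m + 2 * (p ^ k * p ^ h) \<and>
        (\<forall>A e. Poly_Mapping.keys A \<subseteq> box D \<and> e \<le> 1 \<longrightarrow>
          [ct (R ^ (m' + e) * A) = ct (R ^ (m + e) * A)] (mod ?M))" by blast
  qed
qed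

text \<open>In blocks of length \<open>p ^ (a - 1) * p ^ j\<close>, an entry of block
  \<open>m\<close> is modulo \<open>p ^ a\<close> the constant term of \<open>R ^ m\<close> times a
  polynomial that does not depend on \<open>m\<close> and has degree at most \<open>D\<close> for
  every \<open>j\<close>. One window bound \<open>C\<close> thus serves all scales.\<close>

lemma linearly_recurrent_ct_seq: "linearly_recurrent (ct_seq P Q (p ^ a))"
proof -
  let ?M = "int (p ^ a)"
  define D where "D = p ^ (a - 1) * laurent_deg P + laurent_deg Q"
  obtain C where C: "\<And>m. \<exists>m'. m < m' \<and> m' \<le> m + C \<and>
     (\<forall>A e. Poly_Mapping.keys A \<subseteq> box D \<and> e \<le> 1 \<longrightarrow>
       [ct (R ^ (m' + e) * A) = ct (R ^ (m + e) * A)] (mod ?M))"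
    using ct_R_window_recurs by blast
  show ?thesis
  \<comment> \<open>The block length will be \<open>p ^ (a - 1) * p ^ j\<close> with
    \<open>p ^ j \<le> p * l\<close>, whence this \<open>c\<close>.\<close>
  proof (rule linearly_recurrentI[where c = "p ^ (a - 1) * p" and C = C])
    fix l :: nat assume "l > 0"
    then obtain i where i: "p ^ i \<le> l" "l < p ^ (i + 1)"
      using ex_power_ivl1[OF p_ge_2, of l] by auto
    define j where "j = Suc i"
    define N where "N = p ^ (a - 1) * p ^ j"
    have "N > 0" using p_ge_2 by (simp add: N_def)
    have "p ^ j \<le> N" using p_ge_2 by (simp add: N_def)
    then have "l \<le> N" using i(2) by (simp add: j_def)
    moreover have "N \<le> p ^ (a - 1) * p * l" using i(1) by (simp add: N_def j_def)
    moreover have "\<exists>m'. m < m' \<and> m' \<le> m + C \<and>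
        (\<forall>x<2 * N. ct_seq P Q (p ^ a) (m' * N + x) = ct_seq P Q (p ^ a) (m * N + x))" for m
    proof -
      obtain m' where m': "m < m'" "m' \<le> m + C" and eq: "\<And>A e. Poly_Mapping.keys A \<subseteq> box D \<Longrightarrow>
          e \<le> 1 \<Longrightarrow> [ct (R ^ (m' + e) * A) = ct (R ^ (m + e) * A)] (mod ?M)"
        using C by meson
      have "ct_seq P Q (p ^ a) (m' * N + x) = ct_seq P Q (p ^ a) (m * N + x)" if "x < 2 * N" for x
      proof -
        define e y where "e = x div N" and "y = x mod N"
        have "y < N" "x = e * N + y" using \<open>N > 0\<close> by (auto simp: e_def y_def)
        have "e \<le> 1" using that by (simp add: e_def less_mult_imp_div_less less_Suc_eq_le[symmetric])
        define A where "A = cartier (p ^ j) (P ^ y * Q)"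
        have block: "[ct (P ^ (n * N + x) * Q) = ct (R ^ (n + e) * A)] (mod ?M)" for n
        proof -
          have "n * N + x = (n + e) * p ^ j * p ^ (a - 1) + y"
            using \<open>x = e * N + y\<close> by (simp add: N_def algebra_simps)
          then show ?thesis
            using ct_R_split[of "n + e" j "P ^ y * Q"] by (simp only: P_power_split A_def)
        qed
        have "Poly_Mapping.keys (P ^ y * Q) \<subseteq> box (y * laurent_deg P + laurent_deg Q)"
          by (intro keys_mult_box keys_power_box keys_box_laurent_deg)
        then have "Poly_Mapping.keys A \<subseteq> box ((y * laurent_deg P + laurent_deg Q) div p ^ j)"
          unfolding A_def using p_ge_2 by (intro keys_cartier_box) auto
        moreover have "(y * laurent_deg P + laurent_deg Q) div p ^ j \<le> D"
        proof -
          have "y * laurent_deg P \<le> p ^ (a - 1) * p ^ j * laurent_deg P"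
            using \<open>y < N\<close> by (intro mult_right_mono) (auto simp: N_def)
          moreover have "laurent_deg Q \<le> p ^ j * laurent_deg Q" using p_ge_2 by simp
          moreover have "p ^ j * D = p ^ (a - 1) * p ^ j * laurent_deg P + p ^ j * laurent_deg Q"
            by (simp add: D_def distrib_left mult_ac)
          ultimately have "y * laurent_deg P + laurent_deg Q \<le> p ^ j * D" by linarith
          then show ?thesis using p_ge_2 by (metis div_le_mono nonzero_mult_div_cancel_left
                not_numeral_le_zero power_not_zero)
        qed
        ultimately have "Poly_Mapping.keys A \<subseteq> box D" using box_mono by blast
        from cong_trans[OF block cong_trans[OF eq[OF this \<open>e \<le> 1\<close>] cong_sym[OF block]]]
        show ?thesis by (simp add: ct_seq_def cong_def)
      qed
      with m' show ?thesis by blast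
    qed
    ultimately show "\<exists>N. l \<le> N \<and> N \<le> p ^ (a - 1) * p * l \<and> (\<forall>m. \<exists>m'. m < m' \<and> m' \<le> m + C \<and>
        (\<forall>x<2 * N. ct_seq P Q (p ^ a) (m' * N + x) = ct_seq P Q (p ^ a) (m * N + x)))"
      by blast
  qed
qed

end

section \<open>Powers with a constant term divisible by \<open>p\<close>\<close>

lemma has_frequency_ct_seq:
  assumes n0: "int p dvd ct (P ^ n0)"
  shows "has_frequency (ct_seq P Q (p ^ a)) 0 1"
proof -
  let ?M = "int (p ^ a)"
  define d where "d = laurent_deg R"
  define D where "D = p ^ (a - 1) * laurent_deg P + laurent_deg Q"
  \<comment> \<open>The \<open>k'\<close> zeros below \<open>n0\<close> separate it from the lower
    digits \<open>t\<close>: \<open>R ^ t * B\<close> has degree below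
    \<open>b ^ i * p ^ k'\<close>.\<close>
  obtain k' where k': "d + D < p ^ k'" using ex_less_power p_ge_2 by blast
  define g where "g = n0 * p ^ k'"
  \<comment> \<open>In base \<open>p ^ k\<close> the number \<open>g\<close> is a single digit, with
    enough leading base-\<open>p\<close> zeros to separate it from the higher digits
    \<open>u\<close>.\<close>
  obtain k where k: "(g + 1) * (d + 1) + D < p ^ k" using ex_less_power p_ge_2 by blast
  define b where "b = p ^ k"
  have "n0 > 0"
  proof (rule ccontr)
    assume "\<not> n0 > 0"
    then have "int p dvd 1" using n0 by simp
    then show False using p_ge_2 by simp
  qed
  then have "g > 0" using p_ge_2 by (simp add: g_def)
  have "g < b" using k by (simp add: b_def)
  have split: "[ct (R ^ (u * b ^ Suc i + g * b ^ i + t) * B) = ct (R ^ u) * (ct (R ^ n0) * ct (R ^ t * B))] (mod ?M)"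
    if t: "t < b ^ i" and B: "Poly_Mapping.keys B \<subseteq> box D" for u t i B
  proof -
    have pos: "b ^ i > 0" using t by linarith
    then have "1 * D \<le> b ^ i * D" by (intro mult_le_mono1) linarith
    then have D: "D \<le> b ^ i * D" by (simp only: mult_1)
    have bnd: "t * d + D < p ^ (k * i + k')"
    proof -
      have "t * d + D \<le> b ^ i * d + b ^ i * D" using t D by (intro add_mono mult_right_mono) auto
      also have "\<dots> = b ^ i * (d + D)" by (simp add: distrib_left)
      also have "\<dots> < b ^ i * p ^ k'" by (rule mult_strict_left_mono[OF k' pos])
      finally show ?thesis by (simp only: b_def power_add power_mult)
    qed
    have bnd': "(g * b ^ i + t) * d + D < p ^ (k * i + k)"
    proof -
      have "(g * b ^ i + t) * d + D \<le> ((g + 1) * b ^ i) * d + b ^ i * D"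
        using t D by (intro add_mono mult_right_mono) auto
      also have "\<dots> = b ^ i * ((g + 1) * d + D)" by (simp add: algebra_simps)
      also have "\<dots> < b ^ i * p ^ k"
        by (rule mult_strict_left_mono[OF _ pos]) (use k in simp)
      finally show ?thesis by (simp only: b_def power_add power_mult)
    qed
    have "[ct (R ^ (u * p ^ (k * i + k)) * (R ^ (g * b ^ i + t) * B))
        = ct (R ^ u) * ct (R ^ (g * b ^ i + t) * B)] (mod ?M)"
      by (rule ct_R_split_small[OF keys_mult_box[OF keys_R_power B]]) (use bnd' in \<open>simp only: d_def\<close>)
    moreover have "[ct (R ^ (n0 * p ^ (k * i + k')) * (R ^ t * B))
        = ct (R ^ n0) * ct (R ^ t * B)] (mod ?M)"
      by (rule ct_R_split_small[OF keys_mult_box[OF keys_R_power B]]) (use bnd in \<open>simp only: d_def\<close>)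
    moreover have "n0 * p ^ (k * i + k') = g * b ^ i" "u * p ^ (k * i + k) = u * b ^ Suc i"
      by (simp_all only: g_def b_def power_add power_mult power_Suc) (simp_all only: mult_ac)
    ultimately have "[ct (R ^ (u * b ^ Suc i) * (R ^ (g * b ^ i + t) * B))
        = ct (R ^ u) * ct (R ^ (g * b ^ i + t) * B)] (mod ?M)"
      "[ct (R ^ (g * b ^ i) * (R ^ t * B)) = ct (R ^ n0) * ct (R ^ t * B)] (mod ?M)"
      by simp_all
    then show ?thesis
      unfolding power_add mult.assoc by (meson cong_trans cong_mult cong_refl)
  qed
  have dvd: "int (p ^ c) dvd ct (R ^ n * B)"
    if "c \<le> a" "c \<le> digit_count b g n" "Poly_Mapping.keys B \<subseteq> box D" for c n B
    using that
  proof (induction c arbitrary: n B)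
    case 0
    then show ?case by simp
  next
    case (Suc c)
    then obtain u i t where *: "t < b ^ i" "n = u * b ^ Suc i + g * b ^ i + t"
      "digit_count b g n = Suc (digit_count b g u)"
      using digit_count_decompose[OF \<open>g > 0\<close> \<open>g < b\<close>, of n] by auto
    \<comment> \<open>Only the lowest part carries \<open>B\<close>; the higher digits contribute
      \<open>ct (R ^ u)\<close>, so the induction continues with \<open>B = 1\<close>.\<close>
    have "int (p ^ c) dvd ct (R ^ u * 1)"
      using Suc.prems *(3) by (intro Suc.IH) (auto simp: box_def)
    moreover have "int p dvd ct (R ^ n0) * ct (R ^ t * B)"
      using n0 by (simp add: p_dvd_ct_R_power_iff)
    ultimately have "int (p ^ c) * int p dvd ct (R ^ u) * (ct (R ^ n0) * ct (R ^ t * B))"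
      by (intro mult_dvd_mono) auto
    then have 1: "int (p ^ Suc c) dvd ct (R ^ u) * (ct (R ^ n0) * ct (R ^ t * B))"
      by (simp add: mult.commute)
    have "int (p ^ Suc c) dvd ?M"
      using Suc.prems(1) by (simp only: of_nat_power le_imp_power_dvd)
    from cong_dvd_modulus[OF split[OF *(1) Suc.prems(3)] this] 1
    show ?case unfolding *(2) by (metis cong_dvd_iff)
  qed
  have "digit_count b g (n div p ^ (a - 1)) < a" if "ct_seq P Q (p ^ a) n \<noteq> 0" for n
  proof (rule ccontr)
    assume *: "\<not> digit_count b g (n div p ^ (a - 1)) < a"
    \<comment> \<open>The quotient becomes an exponent of \<open>R\<close>; the remainder
      \<open>x\<close> leaves \<open>P ^ x * Q\<close>, which fits in \<open>box D\<close>.\<close>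
    define x where "x = n mod p ^ (a - 1)"
    have "x < p ^ (a - 1)" using p_ge_2 by (simp add: x_def)
    then have "x * laurent_deg P + laurent_deg Q \<le> D" by (simp add: D_def)
    moreover have "Poly_Mapping.keys (P ^ x * Q) \<subseteq> box (x * laurent_deg P + laurent_deg Q)"
      by (intro keys_mult_box keys_power_box keys_box_laurent_deg)
    ultimately have "Poly_Mapping.keys (P ^ x * Q) \<subseteq> box D" using box_mono by blast
    with * have "?M dvd ct (R ^ (n div p ^ (a - 1)) * (P ^ x * Q))" by (intro dvd) auto
    moreover have "P ^ n * Q = R ^ (n div p ^ (a - 1)) * (P ^ x * Q)"
      using P_power_split[of "n div p ^ (a - 1)" x Q] by (simp only: x_def div_mult_mod_eq)
    ultimately show False using that by (simp add: ct_seq_def)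
  qed
  then show ?thesis
    using p_ge_2 by (intro has_frequency_1_if_digit_count[OF \<open>g > 0\<close> \<open>g < b\<close>, of "p ^ (a - 1)"]) auto
qed

end

section \<open>A bound for the first divisible constant term\<close>

lemma pcong_power_ct_dvd_iff:
  assumes "pcong p P P'"
  shows "int p dvd ct (P ^ n) \<longleftrightarrow> int p dvd ct (P' ^ n)"
  using pcong_ct[OF pcong_power[OF assms]] by (rule cong_dvd_iff)

text \<open>The least \<open>n\<close> depends only on the coefficients modulo \<open>p\<close> in
  \<open>box d\<close>, which leave finitely many cases.\<close>

lemma ex_bound_first_dvd:
  assumes "p > 0"
  shows "\<exists>B. \<forall>P :: 'r::finite laurent. laurent_deg P = d \<longrightarrow>
    (\<exists>n. int p dvd ct (P ^ n)) \<longrightarrow> (\<exists>n<B. int p dvd ct (P ^ n))"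
proof -
  let ?S = "{P :: 'r laurent. laurent_deg P = d}"
  define res where "res P = (\<lambda>e\<in>box d. Poly_Mapping.lookup P e mod int p)" for P :: "'r laurent"
  let ?f = "\<lambda>P :: 'r laurent. LEAST n. int p dvd ct (P ^ n)"
  have "res ` ?S \<subseteq> box d \<rightarrow>\<^sub>E {0..<int p}"
    using assms by (auto simp: res_def)
  then have fin: "finite (res ` ?S)"
    by (rule finite_subset) (intro finite_PiE finite_box, auto)
  \<comment> \<open>If no \<open>n\<close> exists, \<open>LEAST\<close> is unspecified, but the
    values still agree because the predicates do.\<close>
  have eq: "?f P = ?f P'" if P: "P \<in> ?S" "P' \<in> ?S" and "res P = res P'" for P P'
  proof -
    have "[Poly_Mapping.lookup P e = Poly_Mapping.lookup P' e] (mod int p)" for e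
    proof (cases "e \<in> box d")
      case True
      then show ?thesis using \<open>res P = res P'\<close> by (metis cong_def res_def restrict_apply')
    next
      case False
      then have "e \<notin> Poly_Mapping.keys P" "e \<notin> Poly_Mapping.keys P'"
        using P keys_box_laurent_deg[of P] keys_box_laurent_deg[of P'] by auto
      then show ?thesis by (simp add: in_keys_iff)
    qed
    then have "pcong p P P'" by (simp add: pcong_iff_lookup)
    then show ?thesis by (simp add: pcong_power_ct_dvd_iff)
  qed
  \<comment> \<open>\<open>?f\<close> factors through \<open>res\<close> by a chosen representative
    of each residue class.\<close>
  have "?f ` ?S \<subseteq> (\<lambda>y. ?f (SOME P. P \<in> ?S \<and> res P = y)) ` res ` ?S"
  proof
    fix x assume "x \<in> ?f ` ?S"
    then obtain P where P: "P \<in> ?S" "x = ?f P" by blast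
    define P' where "P' = (SOME P'. P' \<in> ?S \<and> res P' = res P)"
    have "P' \<in> ?S \<and> res P' = res P"
      unfolding P'_def by (rule someI[of _ P]) (use P in auto)
    then have "x = ?f P'" using P eq[of P P'] by simp
    with P(1) show "x \<in> (\<lambda>y. ?f (SOME P. P \<in> ?S \<and> res P = y)) ` res ` ?S"
      unfolding P'_def by (intro image_eqI[of _ _ "res P"] imageI)
  qed
  with fin have "finite (?f ` ?S)" using finite_surj by blast
  show ?thesis
  proof (rule exI[of _ "Suc (Max (?f ` ?S))"], intro allI impI)
    fix P :: "'r laurent" assume "laurent_deg P = d" and ex: "\<exists>n. int p dvd ct (P ^ n)"
    then have "?f P \<le> Max (?f ` ?S)" using \<open>finite (?f ` ?S)\<close> by (intro Max_ge) auto
    then show "\<exists>n<Suc (Max (?f ` ?S)). int p dvd ct (P ^ n)"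
      using LeastI_ex[OF ex] by (intro exI[of _ "?f P"]) auto
  qed
qed

text \<open>\<open>B\<close> is chosen before \<open>P\<close>, so the bound depends on
  \<open>p\<close> and the degree only. The equivalence asks for a nonzero value because the zero
  sequence, as for \<open>Q = 0\<close>, is linearly recurrent whatever \<open>P\<close> is.\<close>

theorem theorem33:
  "\<exists>B :: nat \<Rightarrow> nat \<Rightarrow> nat. \<forall>(P :: 'r::finite laurent) (p :: nat). prime p \<longrightarrow>
     ((\<exists>n. int p dvd ct (P ^ n)) \<longrightarrow> (\<exists>n0 < B p (laurent_deg P). int p dvd ct (P ^ n0))) \<and>
     (\<forall>(Q :: 'r laurent) (a :: nat). a \<ge> 1 \<longrightarrow>
        ((\<exists>n. ct_seq P Q (p ^ a) n \<noteq> 0) \<longrightarrow>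
           (linearly_recurrent (ct_seq P Q (p ^ a)) \<longleftrightarrow> (\<forall>n. \<not> int p dvd ct (P ^ n)))) \<and>
        ((\<forall>n. \<not> int p dvd ct (P ^ n)) \<longrightarrow> linearly_recurrent (ct_seq P Q (p ^ a))) \<and>
        (\<not> linearly_recurrent (ct_seq P Q (p ^ a)) \<longrightarrow>
           has_frequency (ct_seq P Q (p ^ a)) 0 1)) \<and>
     (\<forall>(Q :: 'r laurent) (Q' :: 'r laurent) (a :: nat) (a' :: nat).
        a \<ge> 1 \<and> a' \<ge> 1 \<and>
        (\<exists>n. ct_seq P Q (p ^ a) n \<noteq> 0) \<and> (\<exists>n. ct_seq P Q' (p ^ a') n \<noteq> 0) \<longrightarrow>
        (linearly_recurrent (ct_seq P Q (p ^ a)) \<longleftrightarrow>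
         linearly_recurrent (ct_seq P Q' (p ^ a'))))"
proof -
  have "\<forall>p d. \<exists>b. prime p \<longrightarrow> (\<forall>P :: 'r laurent. laurent_deg P = d \<longrightarrow>
      (\<exists>n. int p dvd ct (P ^ n)) \<longrightarrow> (\<exists>n<b. int p dvd ct (P ^ n)))"
  proof (intro allI)
    fix p d
    show "\<exists>b. prime p \<longrightarrow> (\<forall>P :: 'r laurent. laurent_deg P = d \<longrightarrow>
      (\<exists>n. int p dvd ct (P ^ n)) \<longrightarrow> (\<exists>n<b. int p dvd ct (P ^ n)))"
      using ex_bound_first_dvd[OF prime_gt_0_nat, of p d, where ?'r = 'r] by blast
  qed
  then obtain B where B: "\<And>p d (P :: 'r laurent). prime p \<Longrightarrow> laurent_deg P = d \<Longrightarrow>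
      \<exists>n. int p dvd ct (P ^ n) \<Longrightarrow> \<exists>n<B p d. int p dvd ct (P ^ n)"
    by metis
  have lr: "linearly_recurrent (ct_seq P Q (p ^ a))"
    if "prime p" "a \<ge> 1" "\<forall>n. \<not> int p dvd ct (P ^ n)" for P Q :: "'r laurent" and p a
  proof -
    interpret prime_power_ct P p a using that by unfold_locales
    show ?thesis using that(3) by (intro linearly_recurrent_ct_seq) blast
  qed
  have freq: "has_frequency (ct_seq P Q (p ^ a)) 0 1"
    if "prime p" "a \<ge> 1" "int p dvd ct (P ^ n)" for P Q :: "'r laurent" and p a n
  proof -
    interpret prime_power_ct P p a using that by unfold_locales
    show ?thesis using that(3) by (rule has_frequency_ct_seq)
  qed
  have iff: "linearly_recurrent (ct_seq P Q (p ^ a)) \<longleftrightarrow> (\<forall>n. \<not> int p dvd ct (P ^ n))"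
    if "prime p" "a \<ge> 1" "\<exists>n. ct_seq P Q (p ^ a) n \<noteq> 0" for P Q :: "'r laurent" and p a
  proof
    assume rec: "linearly_recurrent (ct_seq P Q (p ^ a))"
    show "\<forall>n. \<not> int p dvd ct (P ^ n)"
    proof (intro allI notI)
      fix n assume "int p dvd ct (P ^ n)"
      from not_uniformly_recurrent_if_frequency_1[OF freq[OF that(1,2) this]]
      show False using that(3) rec by (auto simp: linearly_recurrent_def)
    qed
  qed (rule lr[OF that(1,2)])
  show ?thesis
  proof (intro exI[of _ B] allI impI conjI; (elim conjE)?)
    fix P :: "'r laurent" and p
    assume "prime p" "\<exists>n. int p dvd ct (P ^ n)"
    then show "\<exists>n0<B p (laurent_deg P). int p dvd ct (P ^ n0)" using B by blast
  next
    fix P Q Q' :: "'r laurent" and p a a'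
    assume "prime p" "a \<ge> 1" "a' \<ge> 1" "\<exists>n. ct_seq P Q (p ^ a) n \<noteq> 0" "\<exists>n. ct_seq P Q' (p ^ a') n \<noteq> 0"
    then show "linearly_recurrent (ct_seq P Q (p ^ a)) \<longleftrightarrow> linearly_recurrent (ct_seq P Q' (p ^ a'))"
      by (simp only: iff)
  qed (use iff lr freq in blast)+
qed

end
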